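(* Let $\mathbb{K}$ be an associative ring with unity (not necessarily commutative). Let $p,q$ be positive integers, let $P=[p]\times[q]$ be the $p\times q$-rectangle, and let $f\in\mathbb{K}^{\widehat{P}}$ be a $\mathbb{K}$-labeling of $P$ such that $R^{p+q}f\neq\bot$, where $R$ is birational rowmotion of $P$. Set $a=f(0)$ and $b=f(1)$. Then $a$ and $b$ are invertible in $\mathbb{K}$, and for every $x\in\widehat{P}$ we have $$\left(R^{p+q}f\right)(x)=a\,b^{-1}\cdot f(x)\cdot a^{-1}\,b.$$
   Context: $\mathbb{K}$ is a fixed associative ring with unity, not necessarily commutative. An element is invertible if it has a two-sided inverse $x^{-1}$. An equality in which an inverse $x^{-1}$ appears is understood to include the assertion that $x$ is invertible (unless this is assumed). $\mathbb{N}=\{0,1,2,\ldots\}$. Extended poset. For a finite poset $P$, $\widehat{P}$ is the poset on the disjoint union $P\sqcup\{0,1\}$ in which $u\le v$ iff ($u,v\in P$ and $u\le v$ in $P$) or $u=0$ or $v=1$. Write $u\lessdot v$ (equivalently $v\gtrdot u$) if $u<v$ and no $w$ satisfies $u<w<v$ (in $\widehat{P}$). Labelings and partial maps. A $\mathbb{K}$-labeling of $P$ is a map $f:\widehat{P}\to\mathbb{K}$; the set of these is $\mathbb{K}^{\widehat{P}}$. A partial map $F:X\dashrightarrow Y$ is a map $X\to Y\sqcup\{\bot\}$, where $\bot$ means "undefined"; it is extended by $F(\bot)=\bot$, and partial maps are composed accordingly. Toggles. For $v\in P$, the toggle $T_v:\mathbb{K}^{\widehat{P}}\dashrightarrow\mathbb{K}^{\widehat{P}}$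 is defined by $(T_vf)(w)=f(w)$ for $w\ne v$ and $$(T_vf)(v)=\Big(\sum_{u\in\widehat{P},\,u\lessdot v}f(u)\Big)\cdot f(v)^{-1}\cdot\Big(\sum_{u\in\widehat{P},\,u\gtrdot v}f(u)^{-1}\Big)^{-1};$$ if any inverse in this formula does not exist, then $T_vf:=\bot$. Birational rowmotion. $R:=T_{v_1}\circ T_{v_2}\circ\cdots\circ T_{v_m}:\mathbb{K}^{\widehat{P}}\dashrightarrow\mathbb{K}^{\widehat{P}}$, where $(v_1,\ldots,v_m)$ is any linear extension of $P$ (a list of all elements of $P$, each exactly once, such that $v_i<v_j$ implies $i<j$); so the toggles at larger elements are applied first. This partial map does not depend on the choice of linear extension. $R^k$ is the $k$-fold composition, $R^0=\mathrm{id}$. Rectangle. For positive integers $p,q$, the $p\times q$-rectangle is $[p]\times[q]$ with $[n]=\{1,\ldots,n\}$ and order $(i,j)\le(i',j')$ iff $i\le i'$ and $j\le j'$. *)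

theory Defs
  imports Main "HOL-Library.Product_Order" "HOL-Library.Extended"
begin

text \<open>
  Rings are types of sort \<open>{ring, monoid_mult}\<close>: associative rings with unity, not necessarily
  commutative. The class \<open>ring_1\<close> would in addition require \<open>0 \<noteq> 1\<close>.
\<close>

definition invertible :: "'k::monoid_mult \<Rightarrow> bool" where
  "invertible x \<longleftrightarrow> (\<exists>y. x * y = 1 \<and> y * x = 1)"

text \<open>Only meaningful on arguments that are invertible, where the inverse is unique.\<close>

definition inv_elt :: "'k::monoid_mult \<Rightarrow> 'k" where
  "inv_elt x = (THE y. x * y = 1 \<and> y * x = 1)"

lemma inv_elt_eqI:
  fixes x y :: "'k::monoid_mult"
  assumes "x * y = 1" and "y * x = 1"
  shows "inv_elt x = y"
  unfolding inv_elt_def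
proof (rule the_equality)
  fix z assume "x * z = 1 \<and> z * x = 1"
  then show "z = y" using assms by (metis mult.assoc mult_1_left mult_1_right)
qed (use assms in simp)

text \<open>
  A finite poset is a finite set \<open>P\<close> of elements of an ordered type. The elements \<open>0\<close> and \<open>1\<close> of
  the extended poset are \<open>Minf\<close> and \<open>Pinf\<close>, and \<open>v \<in> P\<close> becomes \<open>Fin v\<close>.
\<close>

definition hat :: "'v set \<Rightarrow> 'v extended set" where
  "hat P = insert Minf (insert Pinf (Fin ` P))"

definition covered_by :: "'v::order set \<Rightarrow> 'v extended \<Rightarrow> 'v extended \<Rightarrow> bool" where
  "covered_by P u v \<longleftrightarrow>
     u \<in> hat P \<and> v \<in> hat P \<and> u < v \<and> \<not> (\<exists>w\<in>hat P. u < w \<and> w < v)"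

text \<open>
  Labelings are total functions on \<open>'v extended\<close>; only their values on \<open>hat P\<close> matter, and toggles
  neither read nor change the values elsewhere. Partial maps are functions into an option type,
  with \<open>None\<close> for ``undefined'', composed by \<open>\<circ>\<^sub>m\<close>.
\<close>

type_synonym ('v, 'k) labeling = "'v extended \<Rightarrow> 'k"

definition toggle ::
  "'v::order set \<Rightarrow> 'v \<Rightarrow> ('v, 'k::{ring, monoid_mult}) labeling \<rightharpoonup> ('v, 'k) labeling" where
  "toggle P v f =
     (let below = (\<Sum>u\<in>{u. covered_by P u (Fin v)}. f u);
          above = (\<Sum>u\<in>{u. covered_by P (Fin v) u}. inv_elt (f u))
      in if invertible (f (Fin v)) \<and> (\<forall>u. covered_by P (Fin v) u \<longrightarrow> invertible (f u)) \<and>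
            invertible above
         then Some (f(Fin v := below * inv_elt (f (Fin v)) * inv_elt above))
         else None)"

definition linear_extension :: "'v::order set \<Rightarrow> 'v list \<Rightarrow> bool" where
  "linear_extension P vs \<longleftrightarrow> distinct vs \<and> set vs = P \<and>
     (\<forall>i<length vs. \<forall>j<length vs. vs ! i < vs ! j \<longrightarrow> i < j)"

text \<open>
  For \<open>vs = [v\<^sub>1, \<dots>, v\<^sub>m]\<close> this is the composition \<open>T\<^sub>1 \<circ>\<^sub>m \<dots> \<circ>\<^sub>m T\<^sub>m\<close> of the toggles at
  \<open>v\<^sub>1, \<dots>, v\<^sub>m\<close>, so the toggle at \<open>v\<^sub>m\<close> acts first. It is birational rowmotion of \<open>P\<close> whenever
  \<open>vs\<close> is a linear extension of \<open>P\<close>.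
\<close>

definition rowmotion ::
  "'v::order set \<Rightarrow> 'v list \<Rightarrow> ('v, 'k::{ring, monoid_mult}) labeling \<rightharpoonup> ('v, 'k) labeling" where
  "rowmotion P vs = foldr (\<lambda>v F. toggle P v \<circ>\<^sub>m F) vs Some"

definition partial_power :: "('a \<rightharpoonup> 'a) \<Rightarrow> nat \<Rightarrow> ('a \<rightharpoonup> 'a)" where
  "partial_power F k = ((\<lambda>G. F \<circ>\<^sub>m G) ^^ k) Some"

text \<open>The order on \<open>nat \<times> nat\<close> is the componentwise one.\<close>

definition rectangle :: "nat \<Rightarrow> nat \<Rightarrow> (nat \<times> nat) set" where
  "rectangle p q = {1..p} \<times> {1..q}"

lemma linear_extension_exists:
  assumes "finite P"
  shows "\<exists>vs. linear_extension P vs"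
  using assms
proof (induction "card P" arbitrary: P)
  case 0
  then have "linear_extension P []" by (simp add: linear_extension_def)
  then show ?case by blast
next
  case (Suc n)
  then have "P \<noteq> {}" by auto
  then obtain m where m: "m \<in> P" "\<And>x. x \<in> P \<Longrightarrow> m \<le> x \<Longrightarrow> m = x"
    using finite_has_maximal[OF Suc.prems] by blast
  have "card (P - {m}) = n" using Suc.hyps(2) m(1) Suc.prems by simp
  then obtain vs where vs: "linear_extension (P - {m}) vs"
    using Suc.hyps(1) Suc.prems by (metis finite_Diff)
  have max: "\<not> m < vs ! j" if "j < length vs" for j
  proof
    assume less: "m < vs ! j"
    have "vs ! j \<in> P" using vs that nth_mem by (fastforce simp: linear_extension_def)
    with m(2) less show False by (metis less_imp_le less_irrefl)
  qed
  have "linear_extension P (vs @ [m])"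
    unfolding linear_extension_def
  proof (intro conjI allI impI)
    show "distinct (vs @ [m])" "set (vs @ [m]) = P"
      using vs m(1) by (auto simp: linear_extension_def)
  next
    fix i j
    assume "i < length (vs @ [m])" "j < length (vs @ [m])"
      and "(vs @ [m]) ! i < (vs @ [m]) ! j"
    then show "i < j"
      using vs max by (auto simp: linear_extension_def nth_append less_Suc_eq split: if_splits)
  qed
  then show ?case by blast
qed

end

theory Submission
  imports Defs
begin

text \<open>
  Let \<open>x\<^sub>l\<close> be the \<open>l\<close>-th iterate of rowmotion, let \<open>y\<^sub>l\<close> be its pointwise inverse, and write
  \<open>v*\<close> for the antipode of \<open>v = (i, j)\<close>. The theorem follows by applying twice the
  reciprocity \<open>b * y\<^sub>l(v) * a = x\<^sub>m(v*)\<close> with \<open>m = l - i - j + 1\<close>. Rowmotion is equivalent to the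
  equation \<open>x\<^sub>l\<^sub>+\<^sub>1(v) * up(v) * x\<^sub>l(v) = down(v)\<close>, where \<open>up(v)\<close> sums \<open>y\<^sub>l\<^sub>+\<^sub>1\<close> over the upper covers of
  \<open>v\<close> and \<open>down(v)\<close> sums \<open>x\<^sub>l\<close> over the lower covers. This equation is compatible with taking
  antipodes, so reciprocity at \<open>v\<close>, at its lower covers and at one of its upper covers gives
  reciprocity at the other upper cover. It remains to treat the edge \<open>j = 1\<close>.

  For \<open>l \<ge> 1\<close>, weight each vertex \<open>v\<close> by the inverse of \<open>x\<^sub>l(v)\<close> times the sum of \<open>y\<^sub>l\<close> over the upper
  covers of \<open>v\<close>, and let \<open>W\<^sub>l(k, v)\<close> be the sum over all descending paths from \<open>(k, q)\<close> to \<open>v\<close> of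
  the product of the weights. Then
  \<open>b * y\<^sub>l(v) = W\<^sub>l(p, v)\<close> and \<open>W\<^sub>l\<^sub>+\<^sub>1(k, (1, 1)) * a = x\<^sub>l(k, q)\<close>. The two are linked by
  the conversion \<open>W\<^sub>l\<^sub>+\<^sub>1(k + 1, (i + 1, 1)) = W\<^sub>l(k, (i, 1))\<close>, which moves both ends of the paths along
  opposite edges of the rectangle.
\<close>

section \<open>Inverses in a noncommutative monoid\<close>

lemma inv_elt_props:
  assumes "invertible (x :: 'k::monoid_mult)"
  shows "x * inv_elt x = 1" "inv_elt x * x = 1"
  using assms inv_elt_eqI unfolding invertible_def by fastforce+

lemma invertibleI: "x * y = 1 \<Longrightarrow> y * x = 1 \<Longrightarrow> invertible x"
  unfolding invertible_def by blast

lemma invertible_inv_elt: "invertible x \<Longrightarrow> invertible (inv_elt x)"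
  using inv_elt_props invertibleI by blast

lemma invertible_mult:
  assumes "invertible (x :: 'k::monoid_mult)" "invertible y"
  shows "invertible (x * y)"
proof (rule invertibleI)
  show "x * y * (inv_elt y * inv_elt x) = 1"
    using assms inv_elt_props by (metis mult.assoc mult_1_right)
  show "inv_elt y * inv_elt x * (x * y) = 1"
    using assms inv_elt_props by (metis mult.assoc mult_1_right)
qed

lemma invertible_cancel_right:
  assumes "invertible (z :: 'k::monoid_mult)"
  shows "x * z = y * z \<longleftrightarrow> x = y"
  using inv_elt_props[OF assms] by (metis mult.assoc mult_1_right)

lemma invertible_cancel_left:
  assumes "invertible (z :: 'k::monoid_mult)"
  shows "z * x = z * y \<longleftrightarrow> x = y"
  using inv_elt_props[OF assms] by (metis mult.assoc mult_1_left)

lemma inv_elt_cancel_assoc: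
  assumes "invertible (z :: 'k::monoid_mult)"
  shows "x * z * inv_elt z = x" "x * inv_elt z * z = x"
    "z * (inv_elt z * x) = x" "inv_elt z * (z * x) = x"
  using inv_elt_props[OF assms] by (metis mult.assoc mult_1_left mult_1_right)+

lemma invertible_mult_leftD:
  assumes "invertible (x * y :: 'k::monoid_mult)" "invertible y"
  shows "invertible x"
  using invertible_mult[OF assms(1) invertible_inv_elt[OF assms(2)]]
  by (simp add: inv_elt_cancel_assoc assms(2))

section \<open>Weighted path sums along an abstract orbit\<close>

text \<open>
  The arguments \<open>m\<close> and \<open>n\<close> count from the top corner: they stand for the vertex
  \<open>(p + 1 - m, q + 1 - n)\<close>. The source of the paths is the virtual vertex \<open>(k, q + 1)\<close>.
\<close>

fun path_sum :: "(nat \<Rightarrow> nat \<Rightarrow> 'k::{ring, monoid_mult}) \<Rightarrow> nat \<Rightarrow> nat \<Rightarrow> nat \<Rightarrow> nat \<Rightarrow> nat \<Rightarrow> 'k" where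
  "path_sum D p q k m 0 = (if Suc p - m = k then 1 else 0)"
| "path_sum D p q k 0 (Suc n) = 0"
| "path_sum D p q k (Suc m) (Suc n) =
     (path_sum D p q k m (Suc n) + path_sum D p q k (Suc m) n) * D (p - m) (q - n)"

text \<open>
  The values of \<open>x\<close> and \<open>y\<close> are padded around the rectangle so that the sums over covers always have
  two terms: the bottom element sits at \<open>(1, 0)\<close> and the top element at \<open>(p, q + 1)\<close>.
\<close>

locale rectangle_orbit =
  fixes p q L :: nat
    and a b :: "'k::{ring, monoid_mult}"
    and x y :: "nat \<Rightarrow> nat \<Rightarrow> nat \<Rightarrow> 'k"
  assumes p_pos: "0 < p" and q_pos: "0 < q"
    and inv_a: "invertible a" and inv_b: "invertible b"
    and xy: "\<lbrakk>l \<le> L; i < p; j < q\<rbrakk> \<Longrightarrow> x l (Suc i) (Suc j) * y l (Suc i) (Suc j) = 1"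
    and yx: "\<lbrakk>l \<le> L; i < p; j < q\<rbrakk> \<Longrightarrow> y l (Suc i) (Suc j) * x l (Suc i) (Suc j) = 1"
    and x_left [simp]: "x l 0 j = 0"
    and x_bot: "x l i 0 = (if i = 1 then a else 0)"
    and y_right [simp]: "y l (Suc p) j = 0"
    and y_top: "y l i (Suc q) = (if i = p then inv_elt b else 0)"
    and inv_up: "\<lbrakk>l < L; i < p; j < q\<rbrakk> \<Longrightarrow>
      invertible (y (Suc l) (Suc (Suc i)) (Suc j) + y (Suc l) (Suc i) (Suc (Suc j)))"
    and trans: "\<lbrakk>l < L; i < p; j < q\<rbrakk> \<Longrightarrow>
      x (Suc l) (Suc i) (Suc j) *
        (y (Suc l) (Suc (Suc i)) (Suc j) + y (Suc l) (Suc i) (Suc (Suc j))) * x l (Suc i) (Suc j)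
      = x l i (Suc j) + x l (Suc i) j"
begin

text \<open>This is the inverse of the path weight. Its invertibility is known only at levels
  \<open>Suc l\<close> with \<open>l < L\<close>, which is why the facts about \<open>W\<close> that
  rest on inverting it are stated for \<open>W (Suc l)\<close>.\<close>

definition E :: "nat \<Rightarrow> nat \<Rightarrow> nat \<Rightarrow> 'k" where
  "E l i j = x l i j * (y l (Suc i) j + y l i (Suc j))"

definition W :: "nat \<Rightarrow> nat \<Rightarrow> nat \<Rightarrow> nat \<Rightarrow> 'k" where
  "W l k i j = path_sum (\<lambda>i j. inv_elt (E l i j)) p q k (Suc p - i) (Suc q - j)"

lemma inv_x: "\<lbrakk>l \<le> L; i < p; j < q\<rbrakk> \<Longrightarrow> invertible (x l (Suc i) (Suc j))"
  using xy yx invertibleI by blast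

lemma inv_E: "\<lbrakk>l < L; i < p; j < q\<rbrakk> \<Longrightarrow> invertible (E (Suc l) (Suc i) (Suc j))"
  unfolding E_def using inv_x inv_up by (simp add: invertible_mult)

lemma E_trans: "\<lbrakk>l < L; i < p; j < q\<rbrakk> \<Longrightarrow>
    E (Suc l) (Suc i) (Suc j) * x l (Suc i) (Suc j) = x l i (Suc j) + x l (Suc i) j"
  unfolding E_def using trans by simp

lemma W_right [simp]: "j < q \<Longrightarrow> W l k (Suc p) (Suc j) = 0"
  by (cases "q - j") (simp_all add: W_def)

lemma W_top: "i \<le> p \<Longrightarrow> W l k i (Suc q) = (if i = k then 1 else 0)"
  by (simp add: W_def)

lemma W_rec:
  assumes "i < p" "j < q"
  shows "W l k (Suc i) (Suc j) =
    (W l k (Suc (Suc i)) (Suc j) + W l k (Suc i) (Suc (Suc j))) * inv_elt (E l (Suc i) (Suc j))"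
proof -
  obtain m n where "p - i = Suc m" "q - j = Suc n"
    using assms by (metis Suc_diff_Suc)
  moreover have "p - m = Suc i" "q - n = Suc j" "p - Suc i = m" "q - Suc j = n"
    using calculation assms by auto
  ultimately show ?thesis by (simp add: W_def)
qed

lemma W_E:
  assumes "l < L" "i < p" "j < q"
  shows "W (Suc l) k (Suc i) (Suc j) * E (Suc l) (Suc i) (Suc j) =
    W (Suc l) k (Suc (Suc i)) (Suc j) + W (Suc l) k (Suc i) (Suc (Suc j))"
  using W_rec[of i j] inv_E[OF assms] assms by (simp add: inv_elt_cancel_assoc)

text \<open>Both sides equal \<open>W (Suc l) * E (Suc l) * x l\<close> at the vertex:
  \<open>E_trans\<close> evaluates the last two factors, \<open>W_E\<close> the first two. Thus the
  path sums at level \<open>l + 1\<close> obey a recursion in the labels of level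
  \<open>l\<close>.\<close>

lemma W_x:
  assumes "l < L" "i < p" "j < q"
  shows "W (Suc l) k (Suc i) (Suc j) * (x l i (Suc j) + x l (Suc i) j) =
    (W (Suc l) k (Suc (Suc i)) (Suc j) + W (Suc l) k (Suc i) (Suc (Suc j))) * x l (Suc i) (Suc j)"
  using E_trans[OF assms] W_E[OF assms] by (metis mult.assoc)

lemma y_E:
  assumes "l \<le> L" "i < p" "j < q"
  shows "y l (Suc i) (Suc j) * E l (Suc i) (Suc j) = y l (Suc (Suc i)) (Suc j) + y l (Suc i) (Suc (Suc j))"
  unfolding E_def using yx[OF assms] by (metis mult.assoc mult_1_left)

lemma rect_down_induct [consumes 2, case_names step]:
  assumes "i < p" "j < q"
    and "\<And>i j. i < p \<Longrightarrow> j < q \<Longrightarrow> (Suc i < p \<Longrightarrow> P (Suc i) j) \<Longrightarrow> (Suc j < q \<Longrightarrow> P i (Suc j)) \<Longrightarrow> P i j"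
  shows "P i j"
  using assms(1,2)
proof (induction "p + q - i - j" arbitrary: i j rule: less_induct)
  case less
  show ?case
    by (rule assms(3)) (use less in auto)
qed

text \<open>By \<open>W_E\<close> and \<open>y_E\<close> the two sides obey the same recursion from
  the top, and they agree on the padding: the source value 1 at \<open>(p, q + 1)\<close> is
  \<open>b * inv_elt b\<close>.\<close>

lemma W_p_eq_y:
  assumes "l < L" "i < p" "j < q"
  shows "W (Suc l) p (Suc i) (Suc j) = b * y (Suc l) (Suc i) (Suc j)"
  using assms(2,3)
proof (induction rule: rect_down_induct)
  case (step i j)
  have "W (Suc l) p (Suc (Suc i)) (Suc j) = b * y (Suc l) (Suc (Suc i)) (Suc j)"
  proof (cases "Suc i < p")
    case False
    with step(1) have "Suc i = p" by simp
    with step(2) show ?thesis by simp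
  qed (use step(3) in simp)
  moreover have "W (Suc l) p (Suc i) (Suc (Suc j)) = b * y (Suc l) (Suc i) (Suc (Suc j))"
  proof (cases "Suc j < q")
    case False
    with step(2) have "Suc j = q" by simp
    with step(1) show ?thesis by (simp add: W_top y_top inv_elt_props inv_b)
  qed (use step(4) in simp)
  ultimately have "W (Suc l) p (Suc i) (Suc j) * E (Suc l) (Suc i) (Suc j) =
      b * y (Suc l) (Suc i) (Suc j) * E (Suc l) (Suc i) (Suc j)"
    using W_E[OF \<open>l < L\<close> step(1,2), of p] y_E[of "Suc l" i j] step(1,2) \<open>l < L\<close>
    by (simp add: mult.assoc distrib_left)
  then show ?case using invertible_cancel_right[OF inv_E[OF \<open>l < L\<close> step(1,2)]] by simp
qed

text \<open>
  Summing \<open>W_x\<close> over the whole rectangle, all terms belonging to inner edges cancel.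
\<close>

lemma W_corner:
  assumes l: "l < L" and k: "k < p"
  shows "W (Suc l) (Suc k) 1 1 * a = x l (Suc k) q"
proof -
  define g where "g = W (Suc l) (Suc k)"
  have diff_sum: "A - C + (B - D) = A + B - (C + D)" for A B C D :: 'k
    by (simp add: algebra_simps)
  have "g (Suc i) (Suc j) * x l i (Suc j) + g (Suc i) (Suc j) * x l (Suc i) j =
      g (Suc (Suc i)) (Suc j) * x l (Suc i) (Suc j) + g (Suc i) (Suc (Suc j)) * x l (Suc i) (Suc j)"
    if "i < p" "j < q" for i j
    using W_x[OF l that, of "Suc k"] by (simp add: g_def algebra_simps)
  \<comment> \<open>The edges in direction \<open>i\<close> and those in direction \<open>j\<close>
    are collected separately, so each double sum telescopes.\<close>
  then have "(\<Sum>i<p. \<Sum>j<q. (g (Suc i) (Suc j) * x l i (Suc j) - g (Suc (Suc i)) (Suc j) * x l (Suc i) (Suc j)))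
      + (\<Sum>i<p. \<Sum>j<q. (g (Suc i) (Suc j) * x l (Suc i) j - g (Suc i) (Suc (Suc j)) * x l (Suc i) (Suc j))) = 0"
    unfolding sum.distrib[symmetric]
    by (intro sum.neutral ballI) (simp add: diff_sum)
  also have "(\<Sum>i<p. \<Sum>j<q. (g (Suc i) (Suc j) * x l i (Suc j) - g (Suc (Suc i)) (Suc j) * x l (Suc i) (Suc j)))
      = (\<Sum>j<q. \<Sum>i<p. (g (Suc i) (Suc j) * x l i (Suc j) - g (Suc (Suc i)) (Suc j) * x l (Suc i) (Suc j)))"
    by (rule sum.swap)
  also have "\<dots> = (\<Sum>j<q. g 1 (Suc j) * x l 0 (Suc j) - g (Suc p) (Suc j) * x l p (Suc j))"
    using sum_lessThan_telescope'[of "\<lambda>i. g (Suc i) (Suc j) * x l i (Suc j)" p for j] by simp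
  also have "\<dots> = 0"
    by (intro sum.neutral) (simp add: g_def)
  also have "(\<Sum>i<p. \<Sum>j<q. (g (Suc i) (Suc j) * x l (Suc i) j - g (Suc i) (Suc (Suc j)) * x l (Suc i) (Suc j)))
     = (\<Sum>i<p. g (Suc i) 1 * x l (Suc i) 0 - g (Suc i) (Suc q) * x l (Suc i) q)"
    using sum_lessThan_telescope'[of "\<lambda>j. g (Suc i) (Suc j) * x l (Suc i) j" q for i] by simp
  \<comment> \<open>Two boundary terms survive: the bottom element at \<open>(1, 0)\<close>,
    labelled \<open>a\<close>, and the source at \<open>(k + 1, q + 1)\<close>, where
    \<open>g\<close> is 1.\<close>
  also have "\<dots> = (\<Sum>i<p. (if i = 0 then g 1 1 * a else 0)) - (\<Sum>i<p. (if i = k then x l (Suc k) q else 0))"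
    unfolding sum_subtractf[symmetric] using W_top[of _ "Suc l" "Suc k"]
    by (intro sum.cong refl) (auto simp: g_def x_bot)
  also have "\<dots> = g 1 1 * a - x l (Suc k) q"
    using p_pos k by simp
  finally show ?thesis by (simp add: g_def)
qed

text \<open>The labels of level \<open>l + 1\<close> govern both sides: \<open>W (Suc l)\<close>
  through \<open>W_E\<close>, and \<open>W (Suc (Suc l))\<close> through \<open>W_x\<close>. A local
  relation \<open>C\<close> between the two families is proved downwards from the top, and on the
  edge \<open>j = 1\<close> it turns one recursion into the other.\<close>

lemma conversion:
  assumes l: "Suc l < L" and k: "k < p" and i: "i < p"
  shows "W (Suc l) k (Suc i) 1 = W (Suc (Suc l)) (Suc k) (Suc (Suc i)) 1"
proof -
  define c g X Y where "c = W (Suc l) k" and "g = W (Suc (Suc l)) (Suc k)"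
    and "X = x (Suc l)" and "Y = y (Suc l)"
  have l': "l < L" using l by simp
  have c_E: "c (Suc i) (Suc j) * X (Suc i) (Suc j) * (Y (Suc (Suc i)) (Suc j) + Y (Suc i) (Suc (Suc j)))
      = c (Suc (Suc i)) (Suc j) + c (Suc i) (Suc (Suc j))" if "i < p" "j < q" for i j
    using W_E[OF l' that, of k] by (simp add: c_def X_def Y_def E_def mult.assoc)
  have g_X: "g (Suc i) (Suc j) * (X i (Suc j) + X (Suc i) j) =
     (g (Suc (Suc i)) (Suc j) + g (Suc i) (Suc (Suc j))) * X (Suc i) (Suc j)" if "i < p" "j < q" for i j
    using W_x[OF l that, of "Suc k"] by (simp add: g_def X_def)
  have XY: "X (Suc i) (Suc j) * Y (Suc i) (Suc j) = 1" "Y (Suc i) (Suc j) * X (Suc i) (Suc j) = 1"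
    if "i < p" "j < q" for i j
    using xy yx that l by (simp_all add: X_def Y_def)
  have inv_X: "invertible (X (Suc i) (Suc j))" if "i < p" "j < q" for i j
    using XY[OF that] invertibleI by blast
  \<comment> \<open>Paths only descend, so from first coordinate \<open>k < p\<close> they never
    reach first coordinate \<open>p\<close>.\<close>
  have c_p: "c p (Suc j) = 0" if "j < q" for j
  proof -
    obtain p' where p': "Suc p' = p" using p_pos gr0_implies_Suc by metis
    then have "p' < p" by simp
    have "c (Suc p') (Suc j) = 0" using that
    proof (induction "q - j" arbitrary: j rule: less_induct)
      case less
      have "c (Suc p') (Suc (Suc j)) = 0"
      proof (cases "Suc j < q")
        case False
        then have "Suc j = q" using less by simp
        then show ?thesis using W_top[of p] k p' by (simp add: c_def)
      qed (use less in simp)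
      then show ?case using W_rec[of p' j "Suc l" k] less.prems \<open>p' < p\<close> by (simp add: c_def p')
    qed
    then show ?thesis using p' by simp
  qed
  \<comment> \<open>The two expressions for the product of \<open>c\<close> and \<open>X\<close> agree because of \<open>g_X\<close>; conversely, together
      they imply the recursion \<open>c_E\<close> for \<open>c\<close>, which determines \<open>c\<close>.\<close>
  have C: "(Suc i < p \<longrightarrow> c (Suc i) (Suc j) * X (Suc i) (Suc j) =
        (c (Suc (Suc i)) (Suc j) + g (Suc (Suc i)) (Suc (Suc j))) * X (Suc (Suc i)) (Suc j)) \<and>
      (Suc j < q \<longrightarrow> c (Suc i) (Suc j) * X (Suc i) (Suc j) =
        (c (Suc i) (Suc (Suc j)) - g (Suc (Suc i)) (Suc (Suc j))) * X (Suc i) (Suc (Suc j)))"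
    if "i < p" "j < q" for i j
    using that
  proof (induction rule: rect_down_induct)
    case (step i j)
    let ?up = "Y (Suc (Suc i)) (Suc j) + Y (Suc i) (Suc (Suc j))"
    have inv_up': "invertible ?up" using inv_up[OF l' step(1,2)] by (simp add: Y_def)
    consider "Suc i < p" "Suc j < q" | "Suc i = p" | "Suc i < p" "Suc j = q"
      using step(1,2) by linarith
    then show ?case
    proof cases
      case 1
      let ?g = "g (Suc (Suc i)) (Suc (Suc j))"
      let ?d = "(c (Suc (Suc i)) (Suc j) + ?g) * X (Suc (Suc i)) (Suc j)"
      let ?d' = "(c (Suc i) (Suc (Suc j)) - ?g) * X (Suc i) (Suc (Suc j))"
      have 2: "c (Suc (Suc i)) (Suc j) * X (Suc (Suc i)) (Suc j) =
          (c (Suc (Suc i)) (Suc (Suc j)) - g (Suc (Suc (Suc i))) (Suc (Suc j))) * X (Suc (Suc i)) (Suc (Suc j))"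
        using step(3) 1 by simp
      have 3: "c (Suc i) (Suc (Suc j)) * X (Suc i) (Suc (Suc j)) =
          (c (Suc (Suc i)) (Suc (Suc j)) + g (Suc (Suc i)) (Suc (Suc (Suc j)))) * X (Suc (Suc i)) (Suc (Suc j))"
        using step(4) 1 by simp
      \<comment> \<open>Fact \<open>2\<close> is the second formula at one upper neighbour,
        \<open>3\<close> the first formula at the other. Both involve \<open>c\<close> at the common
        upper neighbour, and its contributions cancel in the difference.\<close>
      have eq: "?d = ?d'"
        using 2 3 g_X[of "Suc i" "Suc j"] 1 by (simp add: algebra_simps)
      \<comment> \<open>For each summand of \<open>?up\<close>, the form of the product is chosen
        whose factor \<open>X\<close> cancels it.\<close>
      have "?d * ?up = ?d * Y (Suc (Suc i)) (Suc j) + ?d' * Y (Suc i) (Suc (Suc j))"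
        by (simp add: eq distrib_left)
      also have "\<dots> = (c (Suc (Suc i)) (Suc j) + ?g) + (c (Suc i) (Suc (Suc j)) - ?g)"
        using XY[of "Suc i" j] XY[of i "Suc j"] 1 step(1,2) by (simp add: mult.assoc)
      also have "\<dots> = c (Suc i) (Suc j) * X (Suc i) (Suc j) * ?up"
        using c_E[OF step(1,2)] by simp
      finally have "c (Suc i) (Suc j) * X (Suc i) (Suc j) = ?d"
        using invertible_cancel_right[OF inv_up'] by metis
      with eq show ?thesis by simp
    next
      case 2
      then show ?thesis using c_p[of j] c_p[of "Suc j"] step(1,2) by (auto simp: g_def)
    next
      case 3
      \<comment> \<open>On the edge \<open>j + 1 = q\<close> the two sources match: \<open>c\<close>
        is 1 at \<open>(i + 1, q + 1)\<close> exactly when \<open>g\<close> is 1 at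
        \<open>(i + 2, q + 1)\<close>. This uses the shift from \<open>k\<close> to
        \<open>k + 1\<close>. Moreover \<open>Y (Suc i) (Suc q)\<close> is 0 as
        \<open>i + 1 < p\<close>.\<close>
      have "c (Suc i) (Suc j) * X (Suc i) (Suc j) * Y (Suc (Suc i)) (Suc j)
        = c (Suc (Suc i)) (Suc j) + g (Suc (Suc i)) (Suc (Suc j))"
        using c_E[OF step(1,2)] 3 W_top[of "Suc i" "Suc l" k] W_top[of "Suc (Suc i)" "Suc (Suc l)" "Suc k"]
        by (simp add: Y_def c_def g_def y_top)
      moreover have "Y (Suc (Suc i)) (Suc j) * X (Suc (Suc i)) (Suc j) = 1"
        using XY 3 step by blast
      ultimately have "c (Suc i) (Suc j) * X (Suc i) (Suc j) =
          (c (Suc (Suc i)) (Suc j) + g (Suc (Suc i)) (Suc (Suc j))) * X (Suc (Suc i)) (Suc j)"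
        by (metis mult.assoc mult_1_right)
      with 3 show ?thesis by simp
    qed
  qed
  from i have "c (Suc i) 1 = g (Suc (Suc i)) 1"
  proof (induction "p - i" arbitrary: i rule: less_induct)
    case less
    show ?case
    proof (cases "Suc i < p")
      case True
      have "c (Suc i) 1 * X (Suc i) 1 = (c (Suc (Suc i)) 1 + g (Suc (Suc i)) 2) * X (Suc (Suc i)) 1"
        using C[of i 0] True less.prems q_pos by (simp add: numeral_2_eq_2)
      also have "c (Suc (Suc i)) 1 = g (Suc (Suc (Suc i))) 1"
        using less.hyps[of "Suc i"] True by simp
      \<comment> \<open>The padding below \<open>(i + 2, 1)\<close> is 0, since \<open>a\<close>
        sits only at \<open>(1, 0)\<close>; hence \<open>g_X\<close> has a single term on its left
        side.\<close>
      also have "(g (Suc (Suc (Suc i))) 1 + g (Suc (Suc i)) 2) * X (Suc (Suc i)) 1 = g (Suc (Suc i)) 1 * X (Suc i) 1"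
        using g_X[of "Suc i" 0] True q_pos by (simp add: X_def x_bot numeral_2_eq_2)
      finally show ?thesis
        using invertible_cancel_right[OF inv_X[of i 0]] less.prems q_pos by simp
    next
      case False
      then have "Suc i = p" using less.prems by simp
      then show ?thesis using c_p[of 0] W_right[of 0] q_pos by (simp add: g_def)
    qed
  qed
  then show ?thesis by (simp add: c_def g_def)
qed

lemma W_shift:
  assumes "l + i < L" "k + i \<le> p" "0 < k" "i < p"
  shows "W (Suc (l + i)) (k + i) (Suc i) 1 = W (Suc l) k 1 1"
  using assms
proof (induction i arbitrary: l k)
  case (Suc i)
  have "W (Suc (l + Suc i)) (k + Suc i) (Suc (Suc i)) 1 = W (Suc (l + i)) (k + i) (Suc i) 1"
    using conversion[of "l + i" "k + i" i] Suc.prems by simp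
  then show ?case using Suc by simp
qed simp

section \<open>Reciprocity and twisted periodicity for abstract orbits\<close>

definition recip :: "nat \<Rightarrow> nat \<Rightarrow> nat \<Rightarrow> bool" where
  "recip l i j \<longleftrightarrow> b * y l i j * a = x (Suc l - i - j) (Suc p - i) (Suc q - j)"

text \<open>Applying \<open>conversion\<close> \<open>i\<close> times turns paths from
  \<open>(p, q)\<close> to \<open>(i + 1, 1)\<close> into paths from \<open>(p - i, q)\<close> to
  \<open>(1, 1)\<close>, \<open>i\<close> levels earlier. The new source is the antipode of the old
  end, and \<open>W_corner\<close> reads off its label.\<close>

lemma recip_bottom:
  assumes "i < p" "Suc i \<le> l" "l \<le> L"
  shows "recip l (Suc i) 1"
proof -
  obtain m where m: "l = Suc (m + i)" using assms(2) by (metis add.commute less_eqE add_Suc)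
  have "b * y l (Suc i) 1 * a = W l p (Suc i) 1 * a"
    using W_p_eq_y[of "m + i" i 0] m assms q_pos by simp
  also have "W l p (Suc i) 1 = W (Suc m) (p - i) 1 1"
    using W_shift[of m i "p - i"] m assms by simp
  also have "\<dots> * a = x m (p - i) q"
    using W_corner[of m "p - Suc i"] m assms by (simp add: Suc_diff_Suc)
  finally show ?thesis by (simp add: recip_def m)
qed

lemma recipD:
  assumes "recip l (Suc i) (Suc j)" "i < p" "j < q" "i + j < l" "l \<le> L"
  shows "x l (Suc i) (Suc j) = a * y (l - Suc (i + j)) (p - i) (q - j) * b"
proof -
  define m where "m = l - Suc (i + j)"
  obtain i' j' where ij: "p - i = Suc i'" "q - j = Suc j'" "i' < p" "j' < q"
    using assms by (metis Suc_diff_Suc diff_less_Suc less_Suc_eq_le not_less Suc_le_eq diff_le_self)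
  have "b * y l (Suc i) (Suc j) * a = x m (Suc i') (Suc j')"
    using assms(1) ij by (simp add: recip_def m_def diff_diff_eq)
  moreover have "x m (Suc i') (Suc j') * y m (Suc i') (Suc j') = 1"
    using xy[of m] ij assms by (simp add: m_def)
  ultimately have "b * (y l (Suc i) (Suc j) * (a * y m (Suc i') (Suc j') * b)) = b * 1"
    by (metis mult.assoc mult_1_left mult_1_right)
  then have "y l (Suc i) (Suc j) * (a * y m (Suc i') (Suc j') * b) = 1"
    using invertible_cancel_left[OF inv_b] by blast
  moreover have "x l (Suc i) (Suc j) * y l (Suc i) (Suc j) = 1"
    using xy assms by simp
  ultimately have "x l (Suc i) (Suc j) = a * y m (Suc i') (Suc j') * b"
    by (metis mult.assoc mult_1_left mult_1_right)
  then show ?thesis by (simp add: ij m_def)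
qed

text \<open>Strong induction on \<open>j\<close>, with \<open>i\<close> and \<open>l\<close> free.
  The bound \<open>i + j < l\<close> keeps the truncated subtraction in \<open>recip\<close>
  exact.\<close>

lemma recip_all:
  assumes "j < q" "i < p" "i + j < l" "l \<le> L"
  shows "recip l (Suc i) (Suc j)"
  using assms
proof (induction j arbitrary: i l rule: less_induct)
  case (less j')
  show ?case
  proof (cases j')
    case 0
    then show ?thesis using recip_bottom less.prems by simp
  next
    case (Suc j)
    obtain n where n: "l = Suc n" using less.prems by (cases l) auto
    \<comment> \<open>The antipode of \<open>v = (i + 1, j + 1)\<close> is
      \<open>(i' + 1, j'' + 1)\<close>. Levels \<open>n\<close> and \<open>n + 1\<close> at
      \<open>v\<close> pair with \<open>m\<close> and \<open>m + 1\<close> there; lower covers of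
      \<open>v\<close> at level \<open>n\<close> pair with its upper covers at level
      \<open>m + 1\<close>, and upper covers of \<open>v\<close> at level \<open>n + 1\<close> with
      its lower covers at level \<open>m\<close>.\<close>
    define m where "m = n - Suc (i + j)"
    define i' j'' where "i' = p - Suc i" and "j'' = q - Suc j"
    have bounds: "n < L" "m < L" "j < q" "i' < p" "j'' < q" "i + j < n"
      and eqs: "p - i = Suc i'" "q - j = Suc j''" "Suc n - Suc (i + j) = Suc m"
      using less.prems Suc n by (auto simp: m_def i'_def j''_def)
    define x0 x1 y0 y1 where "x0 = x m (Suc i') (Suc j'')" and "x1 = x (Suc m) (Suc i') (Suc j'')"
      and "y0 = y m (Suc i') (Suc j'')" and "y1 = y (Suc m) (Suc i') (Suc j'')"
    define u1 u2 where "u1 = y (Suc m) (Suc (Suc i')) (Suc j'')"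
      and "u2 = y (Suc m) (Suc i') (Suc (Suc j''))"
    define w1 w2 where "w1 = y (Suc n) (Suc (Suc i)) (Suc j)" and "w2 = y (Suc n) (Suc i) (Suc (Suc j))"
    have IH: "recip l (Suc i) (Suc k)" if "k \<le> j" "i < p" "i + k < l" "l \<le> L" for i k l
      using less.IH[of k i l] that less.prems Suc by simp
    have v1: "x (Suc n) (Suc i) (Suc j) = a * y1 * b"
      using recipD[OF IH] less.prems bounds eqs by (simp add: y1_def)
    have v0: "x n (Suc i) (Suc j) = a * y0 * b"
      using recipD[OF IH] less.prems bounds eqs by (simp add: y0_def m_def)
    have d1: "x n i (Suc j) = a * u1 * b"
    proof (cases i)
      case 0
      then have "Suc i' = p" using eqs by simp
      then show ?thesis using 0 by (simp add: u1_def)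
    next
      case (Suc k)
      have "n - Suc (k + j) = Suc m" "p - k = Suc (Suc i')"
        using Suc bounds eqs less.prems by (auto simp: m_def)
      then show ?thesis
        using recipD[OF IH, of j k n] Suc less.prems bounds eqs by (simp add: u1_def)
    qed
    \<comment> \<open>The padding is reciprocal too: for \<open>j = 0\<close> the bottom label
      \<open>a\<close> faces the top entry \<open>inv_elt b\<close>, and zeros face zeros.\<close>
    have d2: "x n (Suc i) j = a * u2 * b"
    proof (cases j)
      case 0
      then have "Suc j'' = q" using eqs by simp
      moreover have "Suc i' = p \<longleftrightarrow> i = 0" using eqs less.prems by auto
      ultimately show ?thesis
        using 0 by (simp add: u2_def x_bot y_top inv_elt_cancel_assoc inv_b)
    next
      case (Suc k)
      have "n - Suc (i + k) = Suc m" "q - k = Suc (Suc j'')"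
        using Suc bounds eqs less.prems by (auto simp: m_def)
      then show ?thesis
        using recipD[OF IH, of k i n] Suc less.prems bounds eqs by (simp add: u2_def)
    qed
    have e1: "b * w1 * a = x m i' (Suc j'')"
    proof (cases "Suc i < p")
      case True
      have "Suc (Suc n) - Suc (Suc i) - Suc j = m" "Suc p - Suc (Suc i) = i'" "Suc q - Suc j = Suc j''"
        using eqs by (auto simp: m_def i'_def)
      then show ?thesis
        using IH[of j "Suc i" "Suc n"] True bounds less.prems n Suc by (simp add: recip_def w1_def)
    next
      case False
      then have "Suc i = p" "i' = 0" using less.prems by (auto simp: i'_def)
      then show ?thesis by (simp add: w1_def)
    qed
    have inv0: "x1 * y1 = 1" "y0 * x0 = 1"
      using xy[of "Suc m"] yx[of m] bounds by (simp_all add: x0_def x1_def y0_def y1_def)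
    have "(a * y1 * b) * (w1 + w2) * (a * y0 * b) = a * u1 * b + a * u2 * b"
      using trans[of n i j] bounds less.prems by (simp add: v1 v0 d1 d2 w1_def w2_def)
    then have "a * (y1 * (b * (w1 + w2) * a) * y0 * b) = a * ((u1 + u2) * b)"
      by (simp add: mult.assoc distrib_left distrib_right)
    then have "y1 * (b * (w1 + w2) * a) * y0 = u1 + u2"
      using invertible_cancel_left[OF inv_a] invertible_cancel_right[OF inv_b] by metis
    \<comment> \<open>Multiplying by \<open>x1\<close> on the left and \<open>x0\<close> on the
      right produces the left side of \<open>trans\<close> at the antipode.\<close>
    then have "b * (w1 + w2) * a = x1 * (u1 + u2) * x0"
      using inv0 by (metis mult.assoc mult_1_left mult_1_right)
    also have "\<dots> = x m i' (Suc j'') + x m (Suc i') j''"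
      using trans[of m i' j''] bounds by (simp add: x1_def x0_def u1_def u2_def)
    finally have "b * w2 * a = x m (Suc i') j''"
      using e1 by (simp add: distrib_left distrib_right)
    moreover have "Suc (Suc n) - Suc i - Suc (Suc j) = m" "Suc p - Suc i = Suc i'" "Suc q - Suc (Suc j) = j''"
      using eqs by (auto simp: m_def j''_def)
    ultimately show ?thesis by (simp add: recip_def w2_def n Suc)
  qed
qed

text \<open>Reciprocity at \<open>v\<close> and then at its antipode lowers the level by
  \<open>i + j + 1\<close> and by \<open>i' + j' + 1\<close>, together exactly
  \<open>p + q\<close>.\<close>

lemma twisted_periodicity:
  assumes "p + q \<le> L" "i < p" "j < q"
  shows "x (p + q) (Suc i) (Suc j) = a * inv_elt b * x 0 (Suc i) (Suc j) * inv_elt a * b"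
proof -
  define i' j' m where "i' = p - Suc i" and "j' = q - Suc j" and "m = Suc (i' + j')"
  have eqs: "i' < p" "j' < q" "p - i = Suc i'" "q - j = Suc j'" "p + q - Suc (i + j) = m"
    "Suc m - Suc i' - Suc j' = 0" "Suc p - Suc i' = Suc i" "Suc q - Suc j' = Suc j" "m \<le> L"
    using assms by (auto simp: i'_def j'_def m_def)
  have "x (p + q) (Suc i) (Suc j) = a * y m (Suc i') (Suc j') * b"
    using recipD[OF recip_all] assms eqs by simp
  moreover have "b * y m (Suc i') (Suc j') * a = x 0 (Suc i) (Suc j)"
    using recip_all[of j' i' m] eqs by (simp add: recip_def m_def)
  then have "y m (Suc i') (Suc j') = inv_elt b * x 0 (Suc i) (Suc j) * inv_elt a"
    using inv_elt_cancel_assoc[OF inv_a] inv_elt_cancel_assoc[OF inv_b] by (metis mult.assoc)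
  ultimately show ?thesis by (simp add: mult.assoc)
qed

end

section \<open>Rowmotion as a system of equations between consecutive labelings\<close>

lemma covered_by_less: "covered_by P u v \<Longrightarrow> u < v"
  by (simp add: covered_by_def)

text \<open>The list \<open>ws\<close> stands for a suffix of a linear extension. When
  \<open>v\<close> is toggled, everything above it already has its final value and everything below
  it still has its old one.\<close>

lemma rowmotion_suffix:
  fixes f h :: "('v::order, 'k::{ring, monoid_mult}) labeling"
  assumes "rowmotion P ws f = Some h" "distinct ws" "sorted_wrt (\<lambda>u v. \<not> v < u) ws"
    and "\<And>u v. u \<in> set ws \<Longrightarrow> v \<in> P \<Longrightarrow> u < v \<Longrightarrow> v \<in> set ws"
  shows "(\<forall>u. u \<notin> Fin ` set ws \<longrightarrow> h u = f u) \<and>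
    (\<forall>v\<in>set ws. invertible (f (Fin v)) \<and> (\<forall>u. covered_by P (Fin v) u \<longrightarrow> invertible (h u)) \<and>
      invertible (\<Sum>u\<in>{u. covered_by P (Fin v) u}. inv_elt (h u)) \<and>
      h (Fin v) = (\<Sum>u\<in>{u. covered_by P u (Fin v)}. f u) * inv_elt (f (Fin v)) *
        inv_elt (\<Sum>u\<in>{u. covered_by P (Fin v) u}. inv_elt (h u)))"
  using assms
proof (induction ws arbitrary: h)
  case Nil
  then show ?case by (simp add: rowmotion_def)
next
  case (Cons v ws)
  obtain h' where h': "rowmotion P ws f = Some h'" and t: "toggle P v h' = Some h"
    using Cons.prems(1) by (auto simp: rowmotion_def map_comp_Some_iff)
  have up: "w' \<in> set ws" if "w \<in> set ws" "w' \<in> P" "w < w'" for w w'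
    using Cons.prems(4)[of w w'] Cons.prems(3) that by auto
  have IH: "\<And>u. u \<notin> Fin ` set ws \<Longrightarrow> h' u = f u"
    "\<And>w. w \<in> set ws \<Longrightarrow> invertible (f (Fin w)) \<and> (\<forall>u. covered_by P (Fin w) u \<longrightarrow> invertible (h' u)) \<and>
      invertible (\<Sum>u\<in>{u. covered_by P (Fin w) u}. inv_elt (h' u)) \<and>
      h' (Fin w) = (\<Sum>u\<in>{u. covered_by P u (Fin w)}. f u) * inv_elt (f (Fin w)) *
        inv_elt (\<Sum>u\<in>{u. covered_by P (Fin w) u}. inv_elt (h' u))"
    using Cons.IH[OF h'] Cons.prems(2,3) up by auto
  have hv: "h u = h' u" if "u \<noteq> Fin v" for u
    using t that by (auto simp: toggle_def Let_def split: if_splits)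
  \<comment> \<open>No element of \<open>v # ws\<close> lies below \<open>v\<close>, so the toggle
    at \<open>v\<close> changes no upper cover of an element of the list.\<close>
  have above: "h u = h' u" if "covered_by P (Fin w) u" "w \<in> set (v # ws)" for u w
  proof (rule hv)
    show "u \<noteq> Fin v"
      using covered_by_less[OF that(1)] that(2) Cons.prems(3) by auto
  qed
  have above_sum: "(\<Sum>u\<in>{u. covered_by P (Fin w) u}. inv_elt (h' u)) =
      (\<Sum>u\<in>{u. covered_by P (Fin w) u}. inv_elt (h u))" if "w \<in> set (v # ws)" for w
    using above that by (intro sum.cong) auto
  have below_sum: "(\<Sum>u\<in>{u. covered_by P u (Fin v)}. h' u) = (\<Sum>u\<in>{u. covered_by P u (Fin v)}. f u)"
  proof (intro sum.cong refl IH(1))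
    fix u assume "u \<in> {u. covered_by P u (Fin v)}"
    then have "u < Fin v" using covered_by_less by blast
    then show "u \<notin> Fin ` set ws" using Cons.prems(3) by auto
  qed
  have "v \<notin> set ws" using Cons.prems(2) by simp
  then have v: "h' (Fin v) = f (Fin v)" using IH(1) by auto
  show ?case
  proof (intro conjI allI impI ballI)
    fix u assume "u \<notin> Fin ` set (v # ws)"
    then show "h u = f u" using hv[of u] IH(1)[of u] by auto
  next
    fix w assume w: "w \<in> set (v # ws)"
    show "invertible (f (Fin w))"
      using w t v IH(2) by (auto simp: toggle_def Let_def split: if_splits)
    show "invertible (h u)" if "covered_by P (Fin w) u" for u
      using w t IH(2) above[OF that w] that by (auto simp: toggle_def Let_def split: if_splits)
    show "invertible (\<Sum>u\<in>{u. covered_by P (Fin w) u}. inv_elt (h u))"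
      using w t IH(2) unfolding above_sum[OF w, symmetric]
      by (auto simp: toggle_def Let_def split: if_splits)
    show "h (Fin w) = (\<Sum>u\<in>{u. covered_by P u (Fin w)}. f u) * inv_elt (f (Fin w)) *
        inv_elt (\<Sum>u\<in>{u. covered_by P (Fin w) u}. inv_elt (h u))"
    proof (cases "w = v")
      case True
      have "h (Fin v) = (\<Sum>u\<in>{u. covered_by P u (Fin v)}. h' u) * inv_elt (h' (Fin v)) *
          inv_elt (\<Sum>u\<in>{u. covered_by P (Fin v) u}. inv_elt (h' u))"
        using t by (auto simp: toggle_def Let_def split: if_splits)
      then show ?thesis
        using True v below_sum above_sum[OF w] by simp
    next
      case False
      then show ?thesis
        unfolding above_sum[OF w, symmetric] using IH(2)[of w] hv[of "Fin w"] w by auto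
    qed
  qed
qed

lemma rowmotion_eq:
  fixes f h :: "('v::order, 'k::{ring, monoid_mult}) labeling"
  assumes "linear_extension P vs" "rowmotion P vs f = Some h"
  shows "h Minf = f Minf" "h Pinf = f Pinf"
    and "\<And>v. v \<in> P \<Longrightarrow> invertible (f (Fin v))"
    and "\<And>v u. v \<in> P \<Longrightarrow> covered_by P (Fin v) u \<Longrightarrow> invertible (h u)"
    and "\<And>v. v \<in> P \<Longrightarrow> invertible (\<Sum>u\<in>{u. covered_by P (Fin v) u}. inv_elt (h u))"
    and "\<And>v. v \<in> P \<Longrightarrow> h (Fin v) = (\<Sum>u\<in>{u. covered_by P u (Fin v)}. f u) * inv_elt (f (Fin v)) *
        inv_elt (\<Sum>u\<in>{u. covered_by P (Fin v) u}. inv_elt (h u))"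
proof -
  have vs: "distinct vs" "set vs = P" "sorted_wrt (\<lambda>u v. \<not> v < u) vs"
    using assms(1) unfolding linear_extension_def sorted_wrt_iff_nth_less
    by (auto dest: less_asym intro: less_trans)
  note * = rowmotion_suffix[OF assms(2) vs(1,3)]
  show "h Minf = f Minf" "h Pinf = f Pinf"
    "\<And>v. v \<in> P \<Longrightarrow> invertible (f (Fin v))"
    "\<And>v u. v \<in> P \<Longrightarrow> covered_by P (Fin v) u \<Longrightarrow> invertible (h u)"
    "\<And>v. v \<in> P \<Longrightarrow> invertible (\<Sum>u\<in>{u. covered_by P (Fin v) u}. inv_elt (h u))"
    "\<And>v. v \<in> P \<Longrightarrow> h (Fin v) = (\<Sum>u\<in>{u. covered_by P u (Fin v)}. f u) * inv_elt (f (Fin v)) *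
        inv_elt (\<Sum>u\<in>{u. covered_by P (Fin v) u}. inv_elt (h u))"
    using * vs(2) by auto
qed

section \<open>Covers in the rectangle and their padded sums\<close>

lemma mem_rectangle: "(i, j) \<in> rectangle p q \<longleftrightarrow> 0 < i \<and> i \<le> p \<and> 0 < j \<and> j \<le> q"
  by (auto simp: rectangle_def)

lemma covered_by_rectangle_Fin:
  "covered_by (rectangle p q) (Fin (i, j)) (Fin (k, l)) \<longleftrightarrow>
    (i, j) \<in> rectangle p q \<and> (k, l) \<in> rectangle p q \<and>
    (k = Suc i \<and> l = j \<or> k = i \<and> l = Suc j)" (is "?L \<longleftrightarrow> ?R")
proof
  assume L: ?L
  then have le: "i \<le> k" "j \<le> l" "\<not> (k \<le> i \<and> l \<le> j)"
    and mem: "(i, j) \<in> rectangle p q" "(k, l) \<in> rectangle p q"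
    by (auto simp: covered_by_def hat_def less_prod_def)
  have nb: "\<not> (Fin (i, j) < w \<and> w < Fin (k, l))" if "w \<in> Fin ` rectangle p q" for w
    using L that by (auto simp: covered_by_def hat_def)
  have "Fin (Suc i, j) \<in> Fin ` rectangle p q" if "i < k"
    using that le mem by (auto simp: rectangle_def)
  then have 1: "k = Suc i \<and> l = j" if "i < k"
    using nb[of "Fin (Suc i, j)"] that le by (auto simp: less_prod_def)
  have "Fin (i, Suc j) \<in> Fin ` rectangle p q" if "j < l"
    using that le mem by (auto simp: rectangle_def)
  then have 2: "k = i \<and> l = Suc j" if "j < l"
    using nb[of "Fin (i, Suc j)"] that le by (auto simp: less_prod_def)
  show ?R using 1 2 le mem by linarith
next
  assume ?R
  then show ?L
    by (auto simp: covered_by_def hat_def less_prod_def)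
qed

lemma covered_by_rectangle_Pinf:
  "covered_by (rectangle p q) (Fin (i, j)) Pinf \<longleftrightarrow> 0 < p \<and> 0 < q \<and> i = p \<and> j = q"
  (is "?L \<longleftrightarrow> ?R")
proof
  assume L: ?L
  then have "i \<in> {1..p}" "j \<in> {1..q}"
    by (auto simp: covered_by_def hat_def rectangle_def)
  moreover from this have "\<not> Fin (i, j) < Fin (p, q)"
    using L by (auto simp: covered_by_def hat_def rectangle_def)
  ultimately show ?R by (auto simp: less_prod_def)
next
  assume ?R
  then show ?L by (auto simp: covered_by_def hat_def less_prod_def rectangle_def)
qed

lemma covered_by_rectangle_Minf:
  "covered_by (rectangle p q) Minf (Fin (i, j)) \<longleftrightarrow> 0 < p \<and> 0 < q \<and> i = 1 \<and> j = 1"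
  (is "?L \<longleftrightarrow> ?R")
proof
  assume L: ?L
  then have "i \<in> {1..p}" "j \<in> {1..q}"
    by (auto simp: covered_by_def hat_def rectangle_def)
  moreover from this have "\<not> Fin (1, 1) < Fin (i, j)"
    using L by (auto simp: covered_by_def hat_def rectangle_def)
  ultimately show ?R by (auto simp: less_prod_def)
next
  assume ?R
  then show ?L by (auto simp: covered_by_def hat_def less_prod_def rectangle_def)
qed

lemma upper_covers_rectangle:
  assumes "i < p" "j < q"
  shows "{u. covered_by (rectangle p q) (Fin (Suc i, Suc j)) u} =
    (if Suc i < p then {Fin (Suc (Suc i), Suc j)} else {}) \<union>
    (if Suc j < q then {Fin (Suc i, Suc (Suc j))} else {}) \<union>
    (if Suc i = p \<and> Suc j = q then {Pinf} else {})" (is "?L = ?R")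
proof (rule set_eqI)
  fix u
  show "u \<in> ?L \<longleftrightarrow> u \<in> ?R"
  proof (cases u)
    case (Fin v)
    then show ?thesis
      using assms by (cases v) (auto simp: covered_by_rectangle_Fin mem_rectangle)
  qed (use assms in \<open>auto simp: covered_by_rectangle_Pinf dest: covered_by_less\<close>)
qed

lemma lower_covers_rectangle:
  assumes "i < p" "j < q"
  shows "{u. covered_by (rectangle p q) u (Fin (Suc i, Suc j))} =
    (if 0 < i then {Fin (i, Suc j)} else {}) \<union>
    (if 0 < j then {Fin (Suc i, j)} else {}) \<union>
    (if i = 0 \<and> j = 0 then {Minf} else {})" (is "?L = ?R")
proof (rule set_eqI)
  fix u
  show "u \<in> ?L \<longleftrightarrow> u \<in> ?R"
  proof (cases u)
    case (Fin v)
    then show ?thesis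
      using assms by (cases v) (auto simp: covered_by_rectangle_Fin mem_rectangle)
  qed (use assms in \<open>auto simp: covered_by_rectangle_Minf dest: covered_by_less\<close>)
qed

definition pad_below :: "(nat \<times> nat, 'k::{ring, monoid_mult}) labeling \<Rightarrow> nat \<Rightarrow> nat \<Rightarrow> 'k" where
  "pad_below h i j = (if j = 0 then if i = 1 then h Minf else 0
     else if i = 0 then 0 else h (Fin (i, j)))"

definition pad_above ::
  "nat \<Rightarrow> nat \<Rightarrow> (nat \<times> nat, 'k::{ring, monoid_mult}) labeling \<Rightarrow> nat \<Rightarrow> nat \<Rightarrow> 'k" where
  "pad_above p q h i j = (if i = Suc p then 0
     else if j = Suc q then if i = p then inv_elt (h Pinf) else 0
     else inv_elt (h (Fin (i, j))))"

lemma sum_lower_covers_rectangle: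
  assumes "i < p" "j < q"
  shows "(\<Sum>u\<in>{u. covered_by (rectangle p q) u (Fin (Suc i, Suc j))}. h u) =
    pad_below h i (Suc j) + pad_below h (Suc i) j"
  unfolding lower_covers_rectangle[OF assms] by (auto simp: pad_below_def)

lemma sum_upper_covers_rectangle:
  assumes "i < p" "j < q"
  shows "(\<Sum>u\<in>{u. covered_by (rectangle p q) (Fin (Suc i, Suc j)) u}. inv_elt (h u)) =
    pad_above p q h (Suc (Suc i)) (Suc j) + pad_above p q h (Suc i) (Suc (Suc j))"
  unfolding upper_covers_rectangle[OF assms] using assms by (auto simp: pad_above_def)

section \<open>From iterated rowmotion to \<open>rectangle_orbit\<close>\<close>

lemma partial_power_orbit:
  assumes "partial_power F n f = Some g"
  obtains h where "h 0 = f" "h n = g" "\<And>k. k < n \<Longrightarrow> F (h k) = Some (h (Suc k))"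
  using assms
proof (induction n arbitrary: g thesis)
  case 0
  then show ?case by (auto simp: partial_power_def)
next
  case (Suc n)
  obtain g' where g': "partial_power F n f = Some g'" "F g' = Some g"
    using Suc.prems(2) by (auto simp: partial_power_def map_comp_Some_iff)
  obtain h where h: "h 0 = f" "h n = g'" "\<And>k. k < n \<Longrightarrow> F (h k) = Some (h (Suc k))"
    using Suc.IH[OF _ g'(1)] by blast
  show ?case
    by (rule Suc.prems(1)[of "h(Suc n := g)"]) (use h g' less_Suc_eq in auto)
qed

theorem theorem4p7:
  fixes p q :: nat
    and vs :: "(nat \<times> nat) list"
    and f g :: "(nat \<times> nat, 'k::{ring, monoid_mult}) labeling"
    and a b :: 'k
  assumes "p > 0" and "q > 0"
    and "linear_extension (rectangle p q) vs"
    and "partial_power (rowmotion (rectangle p q) vs) (p + q) f = Some g"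
    and "a = f Minf" and "b = f Pinf"
  shows "invertible a \<and> invertible b \<and>
    (\<forall>x\<in>hat (rectangle p q). g x = a * inv_elt b * f x * inv_elt a * b)"
proof -
  let ?R = "rectangle p q"
  define L where "L = p + q"
  obtain h where h: "h 0 = f" "h L = g"
    and step: "\<And>k. k < L \<Longrightarrow> rowmotion ?R vs (h k) = Some (h (Suc k))"
    using partial_power_orbit[OF assms(4)] L_def by metis
  note rm = rowmotion_eq[OF assms(3) step]
  have L: "1 < L" using assms(1,2) by (simp add: L_def)
  have mem: "(Suc i, Suc j) \<in> ?R \<longleftrightarrow> i < p \<and> j < q" for i j
    by (auto simp: rectangle_def)
  have ends: "h k Minf = a \<and> h k Pinf = b" if "k \<le> L" for k
    using that by (induction k) (simp_all add: h assms(5,6) rm(1,2))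
  define x y where "x k = pad_below (h k)" and "y k = pad_above p q (h k)" for k
  have x_Fin: "x k (Suc i) (Suc j) = h k (Fin (Suc i, Suc j))" for k i j
    by (simp add: x_def pad_below_def)
  have y_Fin: "y k (Suc i) (Suc j) = inv_elt (h k (Fin (Suc i, Suc j)))" if "i < p" "j < q" for k i j
    using that by (simp add: y_def pad_above_def)
  have up: "invertible (y (Suc k) (Suc (Suc i)) (Suc j) + y (Suc k) (Suc i) (Suc (Suc j)))"
    if "k < L" "i < p" "j < q" for k i j
    using rm(5)[of k "(Suc i, Suc j)"] that
    by (simp add: sum_upper_covers_rectangle mem y_def)
  have eq: "x (Suc k) (Suc i) (Suc j) = (x k i (Suc j) + x k (Suc i) j) * inv_elt (x k (Suc i) (Suc j)) *
      inv_elt (y (Suc k) (Suc (Suc i)) (Suc j) + y (Suc k) (Suc i) (Suc (Suc j)))"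
    if "k < L" "i < p" "j < q" for k i j
    using rm(6)[of k "(Suc i, Suc j)"] that
    by (simp add: sum_upper_covers_rectangle sum_lower_covers_rectangle mem y_def x_def pad_below_def[of _ "Suc i" "Suc j"])
  have inv_less: "invertible (x k (Suc i) (Suc j))" if "k < L" "i < p" "j < q" for k i j
    using rm(3)[of k "(Suc i, Suc j)"] that by (simp add: mem x_Fin)
  obtain p' q' where pq: "p = Suc p'" "q = Suc q'"
    using assms(1,2) gr0_implies_Suc by metis
  \<comment> \<open>The toggle at \<open>(p, q)\<close> inverts the label of its upper cover
    \<open>Pinf\<close>.\<close>
  have inv_b: "invertible b"
    using rm(4)[of 0 "(p, q)" Pinf] mem[of p' q'] ends[of 1] L assms(1,2)
    by (simp add: pq covered_by_rectangle_Pinf)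
  have x_below: "x k 0 (Suc 0) + x k (Suc 0) 0 = a" if "k \<le> L" for k
    using ends[OF that] by (simp add: x_def pad_below_def)
  \<comment> \<open>As \<open>L > 1\<close>, the second application of rowmotion inverts the level 1
    label of \<open>(1, 1)\<close>, which is \<open>a\<close> times two invertible factors.\<close>
  have inv_a: "invertible a"
  proof -
    have "invertible (a * inv_elt (x 0 (Suc 0) (Suc 0)) *
        inv_elt (y (Suc 0) (Suc (Suc 0)) (Suc 0) + y (Suc 0) (Suc 0) (Suc (Suc 0))))"
      using inv_less[of 1 0 0] eq[of 0 0 0] x_below[of 0] L assms(1,2) by simp
    then show ?thesis
      using up[of 0 0 0] inv_less[of 0 0 0] L assms(1,2)
      by (meson invertible_mult_leftD invertible_inv_elt less_trans zero_less_one)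
  qed
  \<comment> \<open>At level \<open>L\<close> no further toggle inverts the labels. A vertex with a
    lower cover in the rectangle was inverted as an upper cover in the last application;
    \<open>(1, 1)\<close> is handled by its explicit value.\<close>
  have inv_x: "invertible (x k (Suc i) (Suc j))" if "k \<le> L" "i < p" "j < q" for k i j
  proof (cases "k < L")
    case False
    then obtain l where l: "k = Suc l" "l < L" using \<open>k \<le> L\<close> L by (cases k) auto
    consider "i = 0" "j = 0" | i' where "i = Suc i'" | j' where "j = Suc j'"
      by (metis not0_implies_Suc)
    then show ?thesis
    proof cases
      case 1
      then show ?thesis
        using eq[of l 0 0] up[of l 0 0] inv_less[of l 0 0] x_below[of l] inv_a l that
        by (simp add: invertible_mult invertible_inv_elt)
    next
      case 2
      then show ?thesis
        using rm(4)[of l "(Suc i', Suc j)" "Fin (Suc i, Suc j)"] l that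
        by (simp add: covered_by_rectangle_Fin mem x_Fin)
    next
      case 3
      then show ?thesis
        using rm(4)[of l "(Suc i, Suc j')" "Fin (Suc i, Suc j)"] l that
        by (simp add: covered_by_rectangle_Fin mem x_Fin)
    qed
  qed (use inv_less that in simp)
  have pads: "x k 0 j = 0" "y k (Suc p) j = 0" for k j
    by (simp_all add: x_def y_def pad_below_def pad_above_def)
  have x_bot: "x k i 0 = (if i = 1 then a else 0)" if "k \<le> L" for k i
    using ends[OF that] by (simp add: x_def pad_below_def)
  have y_top: "y k i (Suc q) = (if i = p then inv_elt b else 0)" if "k \<le> L" for k i
    using ends[OF that] by (simp add: y_def pad_above_def)
  have xy: "x k (Suc i) (Suc j) * y k (Suc i) (Suc j) = 1" "y k (Suc i) (Suc j) * x k (Suc i) (Suc j) = 1"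
    if "k \<le> L" "i < p" "j < q" for k i j
    using inv_elt_props[OF inv_x[OF that]] that by (simp_all add: y_Fin x_Fin)
  have tr: "x (Suc k) (Suc i) (Suc j) *
        (y (Suc k) (Suc (Suc i)) (Suc j) + y (Suc k) (Suc i) (Suc (Suc j))) * x k (Suc i) (Suc j)
      = x k i (Suc j) + x k (Suc i) j" if "k < L" "i < p" "j < q" for k i j
    unfolding eq[OF that] by (simp add: inv_elt_cancel_assoc up inv_less that)
  \<comment> \<open>The boundary assumptions of the locale range over all levels, so the orbit is
    replaced by level 0 beyond \<open>L\<close>.\<close>
  interpret rectangle_orbit p q L a b "\<lambda>k. if k \<le> L then x k else x 0" "\<lambda>k. if k \<le> L then y k else y 0"
  proof unfold_locales
    show "0 < p" "0 < q" "invertible a" "invertible b"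
      using assms(1,2) inv_a inv_b by auto
  qed (simp_all add: pads x_bot y_top xy tr up)
  have "g u = a * inv_elt b * f u * inv_elt a * b" if "u \<in> hat ?R" for u
  proof (cases u)
    case (Fin v)
    then obtain i j where v: "v = (Suc i, Suc j)" "i < p" "j < q"
      using \<open>u \<in> hat ?R\<close>
      by (cases v) (auto simp: hat_def mem_rectangle gr0_conv_Suc Suc_le_eq)
    then show ?thesis
      using twisted_periodicity[of i j] Fin h by (simp add: x_Fin L_def)
  next
    case Minf
    then show ?thesis using ends[of L] h assms(5) inv_a inv_b by (simp add: inv_elt_cancel_assoc)
  next
    case Pinf
    then show ?thesis
      using ends[of L] h assms(6) inv_a inv_b by (simp add: inv_elt_cancel_assoc inv_elt_props)
  qed
  with inv_a inv_b show ?thesis by blast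
qed

end
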